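(* The graph $C_5\times C_2$ has Gram dimension $4$, i.e., $\mathrm{gd}(C_5\times C_2)=4$.
   Context: For a graph $G=([n],E)$, the Gram dimension $\mathrm{gd}(G)$ is the smallest integer $k\ge 1$ such that for every real symmetric positive semidefinite $n\times n$ matrix $X$ there exists a positive semidefinite $n\times n$ matrix $X'$ of rank at most $k$ with $X'_{ii}=X_{ii}$ for all $i\in[n]$ and $X'_{ij}=X_{ij}$ for all edges $ij\in E$. $C_5\times C_2$ is the pentagonal prism (the Cartesian product of a 5-cycle with a single edge): the graph on node set $\{1,\dots,10\}$ whose edges are those of the two 5-circuits $(1,3,5,7,9)$ and $(2,4,6,8,10)$ together with the five edges $(1,2),(3,4),(5,6),(7,8),(9,10)$. *)

theory Defs
  imports "HOL-Analysis.Analysis" "HOL-Library.Numeral_Type"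
begin

definition pos_semidef :: "real^'n^'n \<Rightarrow> bool" where
  "pos_semidef A \<longleftrightarrow> transpose A = A \<and> (\<forall>x. 0 \<le> x \<bullet> (A *v x))"

text \<open>A graph is given by its edge set, a set of two-element subsets of the finite vertex type
  \<^typ>\<open>'n\<close>, which is also the index type of the matrices.\<close>

definition gram_bound :: "'n::finite set set \<Rightarrow> nat \<Rightarrow> bool" where
  "gram_bound E k \<longleftrightarrow>
     (\<forall>X :: real^'n^'n. pos_semidef X \<longrightarrow>
       (\<exists>X' :: real^'n^'n. pos_semidef X' \<and> rank X' \<le> k \<and>
          (\<forall>i. X' $ i $ i = X $ i $ i) \<and>
          (\<forall>i j. {i, j} \<in> E \<longrightarrow> X' $ i $ j = X $ i $ j)))"

definition gram_dim :: "'n::finite set set \<Rightarrow> nat" where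
  "gram_dim E = (LEAST k. 1 \<le> k \<and> gram_bound E k)"

text \<open>The minimum is attained, so \<open>LEAST\<close> is not underspecified.\<close>

lemma gram_bound_CARD: "gram_bound (E :: 'n::finite set set) CARD('n)"
  unfolding gram_bound_def using rank_bound by (metis min.bounded_iff)

lemma gram_dim_bound: "1 \<le> gram_dim E \<and> gram_bound E (gram_dim E)" for E :: "'n::finite set set"
  unfolding gram_dim_def
  by (rule LeastI[where k = "CARD('n)"]) (simp add: gram_bound_CARD Suc_leI)

text \<open>The numeral type \<^typ>\<open>10\<close> has exactly ten elements, and the numerals \<open>1, \<dots>, 10\<close> denote
  them without repetition (arithmetic is modulo ten, so the vertex \<open>10\<close> is the element \<open>0\<close>).\<close>

definition C5_times_C2 :: "10 set set" where
  "C5_times_C2 =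
     {{1, 3}, {3, 5}, {5, 7}, {7, 9}, {9, 1},
      {2, 4}, {4, 6}, {6, 8}, {8, 10}, {10, 2},
      {1, 2}, {3, 4}, {5, 6}, {7, 8}, {9, 10}}"

lemma C5_times_C2_simple: "\<forall>e\<in>C5_times_C2. card e = 2"
  unfolding C5_times_C2_def by simp

lemma vertices_distinct: "distinct [1, 2, 3, 4, 5, 6, 7, 8, 9, 10 :: 10]"
  by simp

end

theory Submission
  imports Defs
begin

text \<open>Upper bound: the vertices 1, 4, 5, 8 form an independent set \<open>I\<close>, and the other six vertices carry
  an octahedron whose antipodal pairs are \<open>3,10\<close>, \<open>2,7\<close>, \<open>6,9\<close> and four of whose triangles are the
  neighbourhoods of the vertices of \<open>I\<close>. By compactness the prescribed matrix may be taken positive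
  definite. Among its completions take one, the Gram matrix of vectors \<open>p\<close>, maximising the sum of the three
  antipodal entries. Duality gives a positive semidefinite stress \<open>W\<close>, equal to \<open>-1\<close> on the antipodal
  pairs and to 0 on all other non-edges, whose rows are linear relations between the \<open>p i\<close>. Let \<open>S\<close> be the Schur
  complement of \<open>W\<close> after eliminating \<open>I\<close>; its rows are relations between the six remaining vectors.

  If \<open>S\<close> had rank 1, none of its entries would vanish, because the antipodal ones do not. For \<open>v\<close> in \<open>I\<close> with
  neighbours \<open>i, j, l\<close> put \<open>t j l = W v j * W v l / W v v\<close>. An octahedron edge \<open>jl\<close> in only one of the four
  triangles that is not an edge of the prism has \<open>S j l = - t j l\<close>, while the edges \<open>23\<close>, \<open>36\<close>, \<open>67\<close> lie in
  two triangles and have two such terms. If two of the three values of \<open>t\<close> at \<open>v\<close> have signs opposite to those of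
  \<open>S\<close>, then the third has the same sign as \<open>S\<close>. Passing through 1, 4, 5, 8 in this order, the term
  of the shared edge at the next triangle must again be opposite to \<open>S\<close>, and the last triangle is contradictory.
  Hence \<open>S\<close> has rank at least 2, the six vectors span at most four dimensions, and each vertex of \<open>I\<close>,
  having only three neighbours, can be placed in the same four-dimensional space.

  Lower bound: the prism has a \<open>K\<^sub>4\<close> minor.\<close>

section \<open>Positive semidefinite matrices\<close>

lemma nonneg_quadratic_imp_discriminant:
  fixes a b c :: real
  assumes "\<And>t. 0 \<le> a + 2 * b * t + c * t\<^sup>2" "0 \<le> c"
  shows "b\<^sup>2 \<le> a * c"
proof (cases "c = 0")
  case True
  have "b = 0"
  proof (rule ccontr)
    assume "b \<noteq> 0"
    \<comment> \<open>At this \<open>t\<close> the affine function takes the value -1.\<close>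
    then show False
      using assms(1)[of "- (a + 1) / (2 * b)"] True by simp
  qed
  then show ?thesis
    using True by simp
next
  case False
  then have "0 < c"
    using assms(2) by simp
  \<comment> \<open>The quadratic is evaluated at its minimiser.\<close>
  have "0 \<le> a + 2 * b * (- b / c) + c * (- b / c)\<^sup>2"
    by (rule assms(1))
  also have "\<dots> = a - b\<^sup>2 / c"
    using \<open>0 < c\<close> by (simp add: power2_eq_square)
  finally show ?thesis
    using \<open>0 < c\<close> by (simp add: pos_divide_le_eq)
qed

lemma pos_semidef_symmetric: "pos_semidef A \<Longrightarrow> A $ i $ j = A $ j $ i"
  unfolding pos_semidef_def by (metis transpose_def vec_lambda_beta)

lemma inner_matrix_vector_eq_sum:
  fixes A :: "real^'n^'n"
  shows "x \<bullet> (A *v y) = (\<Sum>i\<in>UNIV. \<Sum>j\<in>UNIV. x $ i * A $ i $ j * y $ j)"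
  by (simp add: inner_vec_def matrix_vector_mult_def sum_distrib_left mult.assoc)

lemma pos_semidef_inner_commute:
  assumes "pos_semidef A"
  shows "x \<bullet> (A *v y) = y \<bullet> (A *v x)"
proof -
  have "transpose A = A"
    using assms by (simp add: pos_semidef_def)
  then show ?thesis
    by (metis dot_lmul_matrix inner_commute transpose_matrix_vector)
qed

lemma pos_semidef_Cauchy_Schwarz:
  fixes A :: "real^'n^'n"
  assumes "pos_semidef A"
  shows "(x \<bullet> (A *v y))\<^sup>2 \<le> (x \<bullet> (A *v x)) * (y \<bullet> (A *v y))"
proof (rule nonneg_quadratic_imp_discriminant)
  show "0 \<le> y \<bullet> (A *v y)"
    using assms by (simp add: pos_semidef_def)
  fix t :: real
  have "0 \<le> (x + t *\<^sub>R y) \<bullet> (A *v (x + t *\<^sub>R y))"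
    using assms by (simp add: pos_semidef_def)
  also have "\<dots> = x \<bullet> (A *v x) + 2 * (x \<bullet> (A *v y)) * t + (y \<bullet> (A *v y)) * t\<^sup>2"
    using pos_semidef_inner_commute[OF assms, of y x]
    by (simp add: matrix_vector_right_distrib matrix_vector_mult_scaleR inner_add_left
        inner_add_right power2_eq_square algebra_simps)
  finally show "0 \<le> x \<bullet> (A *v x) + 2 * (x \<bullet> (A *v y)) * t + (y \<bullet> (A *v y)) * t\<^sup>2" .
qed

lemma pos_semidef_form_eq_0_imp:
  fixes A :: "real^'n^'n"
  assumes "pos_semidef A" "x \<bullet> (A *v x) = 0"
  shows "A *v x = 0"
proof -
  have "((A *v x) \<bullet> (A *v x))\<^sup>2 \<le> 0"
    using pos_semidef_Cauchy_Schwarz[OF assms(1), of "A *v x" x] assms(2) by simp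
  then show ?thesis
    by simp
qed

lemma inner_axis_matrix_axis:
  fixes A :: "real^'n^'n"
  shows "axis i 1 \<bullet> (A *v axis j 1) = A $ i $ j"
  by (simp add: inner_axis' matrix_vector_mult_basis column_def)

lemma pos_semidef_diag_nonneg: "pos_semidef A \<Longrightarrow> 0 \<le> A $ i $ i"
  by (metis inner_axis_matrix_axis pos_semidef_def)

lemma pos_semidef_entry_square_le:
  assumes "pos_semidef A"
  shows "(A $ i $ j)\<^sup>2 \<le> A $ i $ i * A $ j $ j"
  using pos_semidef_Cauchy_Schwarz[OF assms, of "axis i 1" "axis j 1"]
  by (simp add: inner_axis_matrix_axis)

lemma pos_semidef_diag_eq_0_imp:
  assumes "pos_semidef A" "A $ i $ i = 0"
  shows "A $ i $ j = 0"
  using pos_semidef_entry_square_le[OF assms(1), of i j] assms(2) by simp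

lemma pos_semidef_gram_matrix:
  fixes p :: "'n::finite \<Rightarrow> 'a::real_inner"
  shows "pos_semidef ((\<chi> i j. p i \<bullet> p j) :: real^'n^'n)"
proof -
  have "x \<bullet> ((\<chi> i j. p i \<bullet> p j) *v x) = (\<Sum>i\<in>UNIV. x $ i *\<^sub>R p i) \<bullet> (\<Sum>i\<in>UNIV. x $ i *\<^sub>R p i)"
    for x :: "real^'n"
    by (simp add: inner_matrix_vector_eq_sum inner_sum_left inner_sum_right sum_distrib_left
        mult.commute mult.left_commute inner_commute)
  then show ?thesis
    by (simp add: pos_semidef_def transpose_def vec_eq_iff inner_commute)
qed

text \<open>Subtracting the pivot term lowers the form at \<open>x\<close> by the square of entry
  \<open>v\<close> of \<open>A *v x\<close>, divided by \<open>A $ v $ v\<close>. Cauchy-Schwarz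
  against \<open>axis v 1\<close> bounds this loss by the form itself.\<close>

lemma pos_semidef_subtract_pivot:
  fixes A :: "real^'n^'n"
  assumes A: "pos_semidef A" and v: "0 < A $ v $ v"
  shows "pos_semidef (\<chi> i j. A $ i $ j - A $ v $ i * A $ v $ j / A $ v $ v)" (is "pos_semidef ?B")
  unfolding pos_semidef_def
proof (intro conjI allI)
  show "transpose ?B = ?B"
    using pos_semidef_symmetric[OF A] by (simp add: transpose_def vec_eq_iff mult.commute)
  fix x :: "real^'n"
  let ?s = "axis v 1 \<bullet> (A *v x)"
  have s: "?s = (\<Sum>i\<in>UNIV. A $ v $ i * x $ i)"
    by (simp add: inner_axis' matrix_vector_mult_def)
  have "x \<bullet> (?B *v x) = x \<bullet> (A *v x) - (\<Sum>i\<in>UNIV. \<Sum>j\<in>UNIV. (A $ v $ i * x $ i) * (A $ v $ j * x $ j) / A $ v $ v)"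
    by (simp add: inner_matrix_vector_eq_sum algebra_simps sum_subtractf)
  also have "(\<Sum>i\<in>UNIV. \<Sum>j\<in>UNIV. (A $ v $ i * x $ i) * (A $ v $ j * x $ j) / A $ v $ v) = ?s\<^sup>2 / A $ v $ v"
    by (simp add: s power2_eq_square sum_product sum_divide_distrib)
  finally have "x \<bullet> (?B *v x) = x \<bullet> (A *v x) - ?s\<^sup>2 / A $ v $ v" .
  moreover have "?s\<^sup>2 \<le> A $ v $ v * (x \<bullet> (A *v x))"
    using pos_semidef_Cauchy_Schwarz[OF A, of "axis v 1" x] by (simp add: inner_axis_matrix_axis)
  ultimately show "0 \<le> x \<bullet> (?B *v x)"
    using v by (simp add: divide_le_eq mult.commute)
qed

text \<open>Cholesky factorisation: each step clears the row of one nonzero diagonal entry and creates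
  no new nonzero diagonal entries.\<close>

lemma pos_semidef_outer_products:
  fixes A :: "real^'n^'n"
  assumes "pos_semidef A"
  shows "\<exists>u :: 'n \<Rightarrow> 'n \<Rightarrow> real. (\<forall>i j. A $ i $ j = (\<Sum>k\<in>UNIV. u k i * u k j)) \<and>
    (\<forall>k i. A $ k $ k = 0 \<longrightarrow> u k i = 0)"
  using assms
proof (induction "card {i. A $ i $ i \<noteq> 0}" arbitrary: A rule: less_induct)
  case less
  show ?case
  proof (cases "\<exists>v. A $ v $ v \<noteq> 0")
    case False
    then have "A $ i $ j = 0" for i j
      using pos_semidef_diag_eq_0_imp[OF less.prems] by blast
    then show ?thesis
      by (intro exI[of _ "\<lambda>_ _. 0"]) simp
  next
    case True
    then obtain v where "A $ v $ v \<noteq> 0" ..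
    then have v: "0 < A $ v $ v"
      using pos_semidef_diag_nonneg[OF less.prems, of v] by simp
    define B where "B = (\<chi> i j. A $ i $ j - A $ v $ i * A $ v $ j / A $ v $ v)"
    have B: "pos_semidef B"
      unfolding B_def by (rule pos_semidef_subtract_pivot[OF less.prems v])
    have "B $ i $ i = 0" if "A $ i $ i = 0" for i
      using pos_semidef_diag_eq_0_imp[OF less.prems that, of v] pos_semidef_symmetric[OF less.prems, of i v] that
      by (simp add: B_def)
    moreover have Bv: "B $ v $ v = 0"
      using v by (simp add: B_def)
    ultimately have "{i. B $ i $ i \<noteq> 0} \<subset> {i. A $ i $ i \<noteq> 0}"
      using v by force
    then have "card {i. B $ i $ i \<noteq> 0} < card {i. A $ i $ i \<noteq> 0}"
      by (intro psubset_card_mono) auto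
    from less.hyps[OF this B] obtain u where
      u: "\<And>i j. B $ i $ j = (\<Sum>k\<in>UNIV. u k i * u k j)" and u0: "\<And>k i. B $ k $ k = 0 \<Longrightarrow> u k i = 0"
      by blast
    \<comment> \<open>Index \<open>v\<close> is free for the pivot factor: as
      \<open>B $ v $ v = 0\<close>, the second conjunct of the induction hypothesis makes
      \<open>u v\<close> vanish.\<close>
    define w where "w = u(v := (\<lambda>i. A $ v $ i / sqrt (A $ v $ v)))"
    have "A $ i $ j = (\<Sum>k\<in>UNIV. w k i * w k j)" for i j
    proof -
      have "(\<Sum>k\<in>UNIV. w k i * w k j) = w v i * w v j + (\<Sum>k\<in>UNIV - {v}. w k i * w k j)"
        by (rule sum.remove) auto
      also have "(\<Sum>k\<in>UNIV - {v}. w k i * w k j) = (\<Sum>k\<in>UNIV - {v}. u k i * u k j)"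
        by (rule sum.cong) (auto simp: w_def)
      also have "\<dots> = B $ i $ j"
        unfolding u by (subst (2) sum.remove[of _ v]) (auto simp: u0[OF Bv])
      finally show ?thesis
        using v by (simp add: w_def B_def)
    qed
    moreover have "w k i = 0" if "A $ k $ k = 0" for k i
      using that v u0 \<open>\<And>i. A $ i $ i = 0 \<Longrightarrow> B $ i $ i = 0\<close> by (auto simp: w_def)
    ultimately show ?thesis
      by blast
  qed
qed

lemma pos_semidef_imp_gram:
  fixes A :: "real^'n^'n"
  assumes "pos_semidef A"
  obtains p :: "'n \<Rightarrow> real^'n" where "\<And>i j. A $ i $ j = p i \<bullet> p j"
proof -
  obtain u :: "'n \<Rightarrow> 'n \<Rightarrow> real" where "\<And>i j. A $ i $ j = (\<Sum>k\<in>UNIV. u k i * u k j)"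
    using pos_semidef_outer_products[OF assms] by blast
  then have "A $ i $ j = (\<chi> k. u k i) \<bullet> (\<chi> k. u k j)" for i j
    by (simp add: inner_vec_def)
  then show thesis
    by (rule that)
qed

text \<open>The inner product is the sum, over coordinates \<open>k\<close>, of the form of
  \<open>W\<close> at the vector of \<open>k\<close>-th coordinates of the \<open>p j\<close>. The
  terms are nonnegative, so each is zero, and a zero of a semidefinite form lies in the
  kernel.\<close>

lemma stress_annihilates_gram_vectors:
  fixes W :: "real^'n^'n" and p :: "'n \<Rightarrow> real^'m"
  assumes W: "pos_semidef W" and "W \<bullet> (\<chi> i j. p i \<bullet> p j) = 0"
  shows "(\<Sum>j\<in>UNIV. W $ i $ j *\<^sub>R p j) = 0"
proof -
  let ?u = "\<lambda>k. (\<chi> j. p j $ k)"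
  have "W \<bullet> (\<chi> i j. p i \<bullet> p j) = (\<Sum>i\<in>UNIV. \<Sum>j\<in>UNIV. \<Sum>k\<in>UNIV. p i $ k * W $ i $ j * p j $ k)"
    by (simp add: inner_vec_def sum_distrib_left algebra_simps)
  also have "\<dots> = (\<Sum>i\<in>UNIV. \<Sum>k\<in>UNIV. \<Sum>j\<in>UNIV. p i $ k * W $ i $ j * p j $ k)"
    by (intro sum.cong[OF refl] sum.swap)
  also have "\<dots> = (\<Sum>k\<in>UNIV. \<Sum>i\<in>UNIV. \<Sum>j\<in>UNIV. p i $ k * W $ i $ j * p j $ k)"
    by (rule sum.swap)
  also have "\<dots> = (\<Sum>k\<in>UNIV. ?u k \<bullet> (W *v ?u k))"
    by (simp add: inner_matrix_vector_eq_sum)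
  finally have "(\<Sum>k\<in>UNIV. ?u k \<bullet> (W *v ?u k)) = 0"
    using assms(2) by simp
  then have "?u k \<bullet> (W *v ?u k) = 0" for k
    using W by (subst (asm) sum_nonneg_eq_0_iff) (auto simp: pos_semidef_def)
  then have "W *v ?u k = 0" for k
    by (rule pos_semidef_form_eq_0_imp[OF W])
  then show ?thesis
    by (simp add: vec_eq_iff matrix_vector_mult_def)
qed

section \<open>Optimal completions and their stresses\<close>

definition completions :: "'n::finite set set \<Rightarrow> real^'n^'n \<Rightarrow> (real^'n^'n) set" where
  "completions E X = {Y. pos_semidef Y \<and> (\<forall>i. Y $ i $ i = X $ i $ i) \<and>
     (\<forall>i j. {i, j} \<in> E \<longrightarrow> Y $ i $ j = X $ i $ j)}"

lemma closed_pos_semidef: "closed {Y :: real^'n^'n. pos_semidef Y}"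
  unfolding pos_semidef_def transpose_def inner_matrix_vector_eq_sum vec_eq_iff
  by (intro closed_Collect_conj closed_Collect_all closed_Collect_le closed_Collect_eq)
    (simp_all, (intro continuous_intros)+)

text \<open>Boundedness comes from the fixed diagonal, which controls every entry of a semidefinite
  matrix.\<close>

lemma compact_completions: "compact (completions E X)"
proof -
  have "closed (completions E X)"
    unfolding completions_def
    by (intro closed_Collect_conj closed_pos_semidef closed_Collect_all closed_Collect_imp
        closed_Collect_eq continuous_intros open_Collect_const)
  moreover have "norm Y \<le> (\<Sum>i\<in>UNIV. \<Sum>j\<in>UNIV. sqrt (X $ i $ i * X $ j $ j))"
    if "Y \<in> completions E X" for Y
  proof -
    have "\<bar>Y $ i $ j\<bar> \<le> sqrt (X $ i $ i * X $ j $ j)" for i j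
      using pos_semidef_entry_square_le[of Y i j] that
      by (auto simp: completions_def intro!: real_le_rsqrt)
    moreover have "norm Y \<le> (\<Sum>i\<in>UNIV. \<Sum>j\<in>UNIV. \<bar>Y $ i $ j\<bar>)"
    proof -
      have "norm Y \<le> (\<Sum>i\<in>UNIV. norm (Y $ i))"
        unfolding norm_vec_def by (rule L2_set_le_sum) simp
      also have "\<dots> \<le> (\<Sum>i\<in>UNIV. \<Sum>j\<in>UNIV. \<bar>Y $ i $ j\<bar>)"
        by (intro sum_mono norm_le_l1_cart)
      finally show ?thesis .
    qed
    ultimately show ?thesis
      by (meson order_trans sum_mono)
  qed
  then have "bounded (completions E X)"
    unfolding bounded_iff by blast
  ultimately show ?thesis
    by (simp add: compact_eq_bounded_closed)
qed

lemma inner_vector_matrix_eq_outer: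
  fixes A :: "real^'n^'n"
  shows "x \<bullet> (A *v x) = A \<bullet> (\<chi> i j. x $ i * x $ j)"
  unfolding inner_matrix_vector_eq_sum by (simp add: inner_vec_def mult.commute mult.left_commute)

text \<open>Semidefinite programming duality. Separating the cone of (not necessarily symmetric)
  matrices with nonnegative quadratic form from the affine pieces with a better objective value
  makes the separating functional vanish on skew-symmetric directions, so that it is symmetric for free.
  The shift by a multiple of the identity is Slater's condition.\<close>

lemma optimal_completion_stress:
  fixes X C :: "real^'n^'n"
  assumes X: "pos_semidef X" and d: "0 < d"
    and C: "transpose C = C" "C \<noteq> 0" "\<And>i. C $ i $ i = 0" "\<And>i j. {i, j} \<in> E \<Longrightarrow> C $ i $ j = 0"
  obtains Y W where "Y \<in> completions E (X + mat d)" "pos_semidef W" "W \<bullet> Y = 0"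
    "\<And>i j. i \<noteq> j \<Longrightarrow> {i, j} \<notin> E \<Longrightarrow> W $ i $ j = - C $ i $ j"
proof -
  let ?X = "X + mat d"
  have mat_d: "x \<bullet> (mat d *v x) = d * (x \<bullet> x)" for x :: "real^'n"
  proof -
    have "mat d *v x = d *\<^sub>R x"
      by (simp add: vec_eq_iff matrix_vector_mult_def mat_def if_distrib[of "\<lambda>t. t * _"] cong: if_cong)
    then show ?thesis
      by simp
  qed
  have "transpose ?X = ?X"
    using pos_semidef_symmetric[OF X] by (simp add: transpose_def mat_def vec_eq_iff)
  then have "pos_semidef ?X"
    using X d by (simp add: pos_semidef_def matrix_vector_mult_add_rdistrib inner_add_right mat_d)
  then have "?X \<in> completions E ?X"
    by (simp add: completions_def)
  then have "\<exists>Y\<in>completions E ?X. \<forall>Z\<in>completions E ?X. C \<bullet> Z \<le> C \<bullet> Y"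
    by (intro continuous_attains_sup compact_completions continuous_intros) auto
  then obtain Y where Y: "Y \<in> completions E ?X"
    and Y_max: "\<And>Z. Z \<in> completions E ?X \<Longrightarrow> C \<bullet> Z \<le> C \<bullet> Y"
    by blast
  have Y_psd: "pos_semidef Y"
    using Y by (simp add: completions_def)

  \<comment> \<open>\<open>P\<close> is the cone without symmetry, \<open>L\<close> the directions
    that keep the prescribed data after symmetrisation, and \<open>T\<close> the part of
    \<open>Y + L\<close> strictly better than \<open>Y\<close>.\<close>
  define P where "P = {Z :: real^'n^'n. \<forall>x. 0 \<le> x \<bullet> (Z *v x)}"
  define L where "L = {D :: real^'n^'n. (\<forall>i. D $ i $ i = 0) \<and> (\<forall>i j. {i, j} \<in> E \<longrightarrow> D $ i $ j + D $ j $ i = 0)}"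
  define T where "T = {Z. Z - Y \<in> L \<and> C \<bullet> Y < C \<bullet> Z}"
  have P_scale: "s *\<^sub>R Z \<in> P" if "Z \<in> P" "0 \<le> s" for s Z
    using that by (simp add: P_def scaleR_matrix_vector_assoc[symmetric])
  have P_add: "Z + Z' \<in> P" if "Z \<in> P" "Z' \<in> P" for Z Z'
    using that by (simp add: P_def matrix_vector_mult_add_rdistrib inner_add_right)
  have L_scale: "s *\<^sub>R D \<in> L" if "D \<in> L" for s D
    using that by (auto simp: L_def distrib_left[symmetric])
  have L_add: "D + D' \<in> L" if D: "D \<in> L" "D' \<in> L" for D D'
    unfolding L_def mem_Collect_eq
  proof (intro conjI allI impI)
    show "(D + D') $ i $ i = 0" for i
      using D by (simp add: L_def)
    fix i j
    assume "{i, j} \<in> E"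
    then have "D $ i $ j + D $ j $ i = 0" "D' $ i $ j + D' $ j $ i = 0"
      using D by (simp_all add: L_def)
    then show "(D + D') $ i $ j + (D + D') $ j $ i = 0"
      by simp
  qed
  have C_L: "C \<in> L"
    using C(3,4) by (auto simp: L_def insert_commute)
  have CC: "0 < C \<bullet> C"
    using C(2) by simp

  have "convex P"
    unfolding convex_def by (auto intro: P_add P_scale)
  moreover have "convex T"
  proof (rule convexI)
    fix A B and u v :: real
    assume AB: "A \<in> T" "B \<in> T" and uv: "0 \<le> u" "0 \<le> v" "u + v = 1"
    have "u *\<^sub>R (A - Y) + v *\<^sub>R (B - Y) \<in> L"
      using AB by (auto simp: T_def intro: L_add L_scale)
    moreover have "u *\<^sub>R (A - Y) + v *\<^sub>R (B - Y) = u *\<^sub>R A + v *\<^sub>R B - (u + v) *\<^sub>R Y"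
      by (simp add: algebra_simps)
    ultimately have "u *\<^sub>R A + v *\<^sub>R B - Y \<in> L"
      using uv by simp
    moreover have "- (C \<bullet> (u *\<^sub>R A + v *\<^sub>R B)) < - (C \<bullet> Y)"
      using convex_bound_lt[of "- (C \<bullet> A)" "- (C \<bullet> Y)" "- (C \<bullet> B)" u v] AB uv
      by (simp add: T_def inner_add_right)
    ultimately show "u *\<^sub>R A + v *\<^sub>R B \<in> T"
      by (simp add: T_def)
  qed
  moreover have "P \<noteq> {}"
    by (auto simp: P_def intro!: exI[of _ 0])
  moreover have T_C: "Y + D + s *\<^sub>R C \<in> T" if "D \<in> L" "C \<bullet> D = 0" "0 < s" for D s
    using that CC by (auto simp: T_def inner_add_right add.assoc intro!: L_add L_scale C_L)
  then have "T \<noteq> {}"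
    using T_C[of 0 1] by (auto simp: L_def)
  \<comment> \<open>The symmetric part of a common point would be a completion beating
    \<open>Y\<close>; symmetrising keeps the objective because \<open>C\<close> is
    symmetric.\<close>
  moreover have "T \<inter> P = {}"
  proof (rule ccontr)
    assume "T \<inter> P \<noteq> {}"
    then obtain Z where Z: "Z \<in> T" "Z \<in> P"
      by blast
    define S where "S = (1/2) *\<^sub>R (Z + transpose Z)"
    have "x \<bullet> (transpose Z *v x) = x \<bullet> (Z *v x)" for x
      by (metis dot_lmul_matrix inner_commute transpose_matrix_vector)
    then have "x \<bullet> (S *v x) = x \<bullet> (Z *v x)" for x
      by (simp add: S_def scaleR_matrix_vector_assoc[symmetric] matrix_vector_mult_add_rdistrib inner_add_right)
    then have "pos_semidef S"
      using Z(2) by (simp add: pos_semidef_def P_def) (simp add: S_def transpose_def vec_eq_iff)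
    moreover have "S $ i $ i = ?X $ i $ i" for i
    proof -
      have "Z $ i $ i = Y $ i $ i"
        using Z(1) by (simp add: T_def L_def)
      then show ?thesis
        using Y by (simp add: S_def transpose_def completions_def)
    qed
    moreover have "S $ i $ j = ?X $ i $ j" if "{i, j} \<in> E" for i j
    proof -
      have "Z $ i $ j - Y $ i $ j + (Z $ j $ i - Y $ j $ i) = 0"
        using Z(1) that by (simp add: T_def L_def)
      moreover have "Y $ j $ i = Y $ i $ j"
        by (rule pos_semidef_symmetric[OF Y_psd])
      ultimately show ?thesis
        using Y that by (simp add: S_def transpose_def completions_def)
    qed
    ultimately have "C \<bullet> S \<le> C \<bullet> Y"
      by (intro Y_max) (simp add: completions_def)
    moreover have "C \<bullet> transpose Z = C \<bullet> Z"
    proof -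
      have "C \<bullet> transpose Z = transpose C \<bullet> Z"
        by (simp add: inner_vec_def transpose_def) (rule sum.swap)
      then show ?thesis
        using C(1) by simp
    qed
    then have "C \<bullet> S = C \<bullet> Z"
      by (simp add: S_def inner_add_right)
    ultimately show False
      using Z(1) by (simp add: T_def)
  qed
  ultimately obtain A b where "A \<noteq> 0" and A_T: "\<And>Z. Z \<in> T \<Longrightarrow> A \<bullet> Z \<le> b"
    and A_P: "\<And>Z. Z \<in> P \<Longrightarrow> b \<le> A \<bullet> Z"
    using separating_hyperplane_sets[of T P] by blast
  have "b \<le> 0"
    using A_P[of 0] by (simp add: P_def)
  then have A_T: "A \<bullet> Z \<le> 0" if "Z \<in> T" for Z
    using A_T[OF that] by simp
  \<comment> \<open>A functional bounded below on a cone is nonnegative there: a negative value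
    could be scaled to \<open>b - 1\<close>.\<close>
  have A_P: "0 \<le> A \<bullet> Z" if "Z \<in> P" for Z
  proof (rule ccontr)
    assume neg: "\<not> 0 \<le> A \<bullet> Z"
    have "b \<le> A \<bullet> (((b - 1) / (A \<bullet> Z)) *\<^sub>R Z)"
      using \<open>b \<le> 0\<close> neg by (intro A_P P_scale that) (simp add: divide_nonpos_neg)
    then show False
      using neg by simp
  qed
  \<comment> \<open>\<open>Y\<close> lies in \<open>P\<close>, and adding small positive multiples
    of \<open>C\<close> to it gives points of \<open>T\<close>.\<close>
  have A_Y: "A \<bullet> Y = 0"
  proof (rule antisym)
    show "0 \<le> A \<bullet> Y"
      using Y_psd by (intro A_P) (simp add: P_def pos_semidef_def)
    show "A \<bullet> Y \<le> 0"
    proof (rule field_le_epsilon)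
      fix e :: real
      assume "0 < e"
      define s where "s = e / (\<bar>A \<bullet> C\<bar> + 1)"
      have "0 < s"
        using \<open>0 < e\<close> by (simp add: s_def)
      then have "A \<bullet> (Y + 0 + s *\<^sub>R C) \<le> 0"
        by (intro A_T T_C) (auto simp: L_def)
      moreover have "s * \<bar>A \<bullet> C\<bar> \<le> e"
        using \<open>0 < e\<close> by (simp add: s_def field_simps)
      moreover have "- (s * \<bar>A \<bullet> C\<bar>) \<le> s * (A \<bullet> C)"
        using \<open>0 < s\<close> by (metis abs_ge_minus_self abs_mult abs_of_pos minus_le_iff)
      ultimately show "A \<bullet> Y \<le> 0 + e"
        by (simp add: inner_add_right)
    qed
  qed
  have A_C: "A \<bullet> C \<le> 0"
    using A_T[OF T_C[of 0 1]] A_Y by (simp add: L_def inner_add_right)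
  have A_L0: "A \<bullet> D = 0" if D: "D \<in> L" "C \<bullet> D = 0" for D
  proof -
    \<comment> \<open>Here \<open>s\<close> ranges over all reals, so a bound from above forces the
      slope to be 0.\<close>
    have le: "s * (A \<bullet> D) \<le> - (A \<bullet> C)" for s
    proof -
      have "A \<bullet> (Y + s *\<^sub>R D + 1 *\<^sub>R C) \<le> 0"
        using D by (intro A_T T_C L_scale) auto
      then show ?thesis
        using A_Y by (simp add: inner_add_right)
    qed
    show ?thesis
    proof (rule ccontr)
      assume "A \<bullet> D \<noteq> 0"
      then show False
        using le[of "(1 - A \<bullet> C) / (A \<bullet> D)"] by simp
    qed
  qed
  \<comment> \<open>\<open>m\<close> is the multiplier of the objective: removing from
    \<open>D\<close> its component along \<open>C\<close> reduces to the previous step.\<close>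
  define m where "m = - (A \<bullet> C) / (C \<bullet> C)"
  have A_L: "A \<bullet> D = - m * (C \<bullet> D)" if "D \<in> L" for D
  proof -
    have "D + (- (C \<bullet> D) / (C \<bullet> C)) *\<^sub>R C \<in> L"
      using that by (intro L_add L_scale C_L)
    moreover have "C \<bullet> (D + (- (C \<bullet> D) / (C \<bullet> C)) *\<^sub>R C) = 0"
      using CC by (simp add: inner_diff_right)
    ultimately have "A \<bullet> (D + (- (C \<bullet> D) / (C \<bullet> C)) *\<^sub>R C) = 0"
      by (rule A_L0)
    then show ?thesis
      using CC by (simp add: m_def inner_diff_right field_simps)
  qed
  \<comment> \<open>Slater's condition: for \<open>m = 0\<close> the functional would vanish at
    \<open>?X\<close>, but \<open>?X\<close> minus a small multiple of \<open>A\<close> still lies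
    in \<open>P\<close>, where \<open>A\<close> is nonnegative.\<close>
  have "m \<noteq> 0"
  proof
    assume "m = 0"
    have "?X - Y \<in> L"
      using Y pos_semidef_symmetric[OF Y_psd] pos_semidef_symmetric[OF \<open>pos_semidef ?X\<close>]
      by (auto simp: L_def completions_def)
    from A_L[OF this] have A_X: "A \<bullet> ?X = 0"
      using \<open>m = 0\<close> A_Y by (simp add: inner_diff_right)
    obtain K where "0 < K" and K: "\<And>x. norm (A *v x) \<le> norm x * K"
      using bounded_linear.pos_bounded[OF matrix_vector_mul_bounded_linear[of A]] by blast
    have "?X - (d / K) *\<^sub>R A \<in> P"
      unfolding P_def
    proof (intro CollectI allI)
      fix x :: "real^'n"
      have "x \<bullet> (A *v x) \<le> norm x * (norm x * K)"
        by (meson K norm_cauchy_schwarz norm_ge_zero mult_left_mono order_trans)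
      then have "(d / K) * (x \<bullet> (A *v x)) \<le> (d / K) * (norm x * (norm x * K))"
        using d \<open>0 < K\<close> by (intro mult_left_mono) auto
      also have "\<dots> = d * (x \<bullet> x)"
        using \<open>0 < K\<close> by (simp add: power2_norm_eq_inner[symmetric] power2_eq_square)
      also have "\<dots> \<le> x \<bullet> (X *v x) + d * (x \<bullet> x)"
        using X by (simp add: pos_semidef_def)
      finally show "0 \<le> x \<bullet> ((?X - (d / K) *\<^sub>R A) *v x)"
        by (simp add: matrix_vector_mult_diff_rdistrib matrix_vector_mult_add_rdistrib inner_add_right
            inner_diff_right mat_d scaleR_matrix_vector_assoc[symmetric])
    qed
    from A_P[OF this] have "(d / K) * (A \<bullet> A) \<le> 0"
      using A_X by (simp add: inner_diff_right)
    moreover have "0 < (d / K) * (A \<bullet> A)"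
      using d \<open>0 < K\<close> \<open>A \<noteq> 0\<close> by simp
    ultimately show False
      by simp
  qed
  moreover have "0 \<le> m"
    using A_C CC by (simp add: m_def divide_nonpos_pos)
  ultimately have m: "0 < m"
    by simp

  define U where "U i j = (axis i (axis j 1) :: real^'n^'n)" for i j
  have U: "A \<bullet> U i j = A $ i $ j" "C \<bullet> U i j = C $ i $ j" for i j
    by (simp_all add: U_def inner_axis)
  have A_sym: "A $ i $ j = A $ j $ i" for i j
  proof -
    \<comment> \<open>This skew-symmetric direction is orthogonal to the symmetric \<open>C\<close>,
      so \<open>A\<close> vanishes on it.\<close>
    have "U i j + (- 1) *\<^sub>R U j i \<in> L"
      by (auto simp: L_def U_def axis_def)
    moreover have "C $ j $ i = C $ i $ j"
      using C(1) by (metis transpose_def vec_lambda_beta)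
    ultimately show ?thesis
      using A_L[of "U i j + (- 1) *\<^sub>R U j i"] by (simp add: U inner_diff_right)
  qed
  have "pos_semidef ((1 / m) *\<^sub>R A)"
    unfolding pos_semidef_def
  proof (intro conjI allI)
    show "transpose ((1 / m) *\<^sub>R A) = (1 / m) *\<^sub>R A"
      using A_sym by (simp add: transpose_def vec_eq_iff)
    fix x :: "real^'n"
    have "(\<chi> i j. x $ i * x $ j) \<in> P"
      using pos_semidef_gram_matrix[of "\<lambda>i. x $ i"] by (simp add: P_def pos_semidef_def)
    then have "0 \<le> x \<bullet> (A *v x)"
      unfolding inner_vector_matrix_eq_outer by (rule A_P)
    then show "0 \<le> x \<bullet> (((1 / m) *\<^sub>R A) *v x)"
      using m by (simp add: scaleR_matrix_vector_assoc[symmetric])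
  qed
  moreover have "((1 / m) *\<^sub>R A) $ i $ j = - C $ i $ j" if "i \<noteq> j" "{i, j} \<notin> E" for i j
  proof -
    have "U i j \<in> L"
      using that by (auto simp: L_def U_def axis_def insert_commute)
    from A_L[OF this] show ?thesis
      using m by (simp add: U)
  qed
  ultimately show thesis
    using that[of Y "(1 / m) *\<^sub>R A"] Y A_Y by simp
qed

section \<open>Vectors satisfying linear relations\<close>

text \<open>Eliminating an independent set \<open>I\<close> of the support graph of \<open>W\<close>. Rows with \<open>W $ v $ v = 0\<close> vanish,
  so that the convention \<open>x / 0 = 0\<close> gives the right formula for them as well.\<close>

definition schur :: "real^'n^'n \<Rightarrow> 'n set \<Rightarrow> 'n \<Rightarrow> 'n \<Rightarrow> real" where
  "schur W I i j = W $ i $ j - (\<Sum>v\<in>I. W $ v $ i * W $ v $ j / W $ v $ v)"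

lemma schur_commute: "pos_semidef W \<Longrightarrow> schur W I i j = schur W I j i"
  unfolding schur_def by (simp add: pos_semidef_symmetric[of W i j] mult.commute)

text \<open>In the relation of row \<open>i\<close>, each \<open>p v\<close> with \<open>v\<close>
  in \<open>I\<close> is replaced by its expression from row \<open>v\<close>. That row involves no
  other vector of \<open>I\<close>, so the substitutions do not interfere.\<close>

lemma schur_relation:
  fixes W :: "real^'n^'n" and p :: "'n \<Rightarrow> 'a::real_vector"
  assumes W: "pos_semidef W"
    and indep: "\<And>v w. v \<in> I \<Longrightarrow> w \<in> I \<Longrightarrow> v \<noteq> w \<Longrightarrow> W $ v $ w = 0"
    and rel: "\<And>i. (\<Sum>j\<in>UNIV. W $ i $ j *\<^sub>R p j) = 0"
  shows "(\<Sum>j\<in>-I. schur W I i j *\<^sub>R p j) = 0"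
proof -
  have split: "(\<Sum>j\<in>UNIV. f j) = (\<Sum>j\<in>-I. f j) + (\<Sum>j\<in>I. f j)" for f :: "'n \<Rightarrow> 'a"
    using sum.union_disjoint[of "-I" I f] by (simp add: Compl_partition2)
  have v: "(\<Sum>j\<in>-I. (W $ v $ i * W $ v $ j / W $ v $ v) *\<^sub>R p j) = - (W $ i $ v *\<^sub>R p v)" if "v \<in> I" for v
  proof (cases "W $ v $ v = 0")
    case True
    then have "W $ i $ v = 0"
      using pos_semidef_diag_eq_0_imp[OF W True, of i] pos_semidef_symmetric[OF W, of i v] by simp
    then show ?thesis
      using True by simp
  next
    case False
    have "(\<Sum>j\<in>I. W $ v $ j *\<^sub>R p j) = (\<Sum>j\<in>{v}. W $ v $ j *\<^sub>R p j)"
      using that indep[of v] by (intro sum.mono_neutral_right) auto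
    then have "(\<Sum>j\<in>-I. W $ v $ j *\<^sub>R p j) = - (W $ v $ v *\<^sub>R p v)"
      using rel[of v] by (simp add: split eq_neg_iff_add_eq_0)
    then have "(W $ v $ i / W $ v $ v) *\<^sub>R (\<Sum>j\<in>-I. W $ v $ j *\<^sub>R p j) = - (W $ v $ i *\<^sub>R p v)"
      using False by simp
    then show ?thesis
      using pos_semidef_symmetric[OF W, of i v] by (simp add: scaleR_sum_right)
  qed
  have "(\<Sum>j\<in>-I. schur W I i j *\<^sub>R p j) =
    (\<Sum>j\<in>-I. W $ i $ j *\<^sub>R p j) - (\<Sum>j\<in>-I. \<Sum>v\<in>I. (W $ v $ i * W $ v $ j / W $ v $ v) *\<^sub>R p j)"
    by (simp add: schur_def scaleR_left_diff_distrib sum_subtractf scaleR_left.sum)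
  also have "(\<Sum>j\<in>-I. \<Sum>v\<in>I. (W $ v $ i * W $ v $ j / W $ v $ v) *\<^sub>R p j) =
    (\<Sum>v\<in>I. \<Sum>j\<in>-I. (W $ v $ i * W $ v $ j / W $ v $ v) *\<^sub>R p j)"
    by (rule sum.swap)
  also have "\<dots> = - (\<Sum>v\<in>I. W $ i $ v *\<^sub>R p v)"
    by (simp add: v sum_negf)
  also have "(\<Sum>j\<in>-I. W $ i $ j *\<^sub>R p j) - - (\<Sum>v\<in>I. W $ i $ v *\<^sub>R p v) = 0"
    using rel[of i] by (simp add: split)
  finally show ?thesis .
qed

text \<open>If \<open>W\<close> is the Gram matrix of vectors \<open>p\<close>, those indexed by
  \<open>I\<close> are mutually orthogonal. Then \<open>y\<close> is the projection of
  \<open>p i\<close> onto their span, and the Schur entry is the squared length of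
  \<open>p i - y\<close>.\<close>

lemma schur_diag_nonneg:
  fixes W :: "real^'n^'n"
  assumes W: "pos_semidef W"
    and indep: "\<And>v w. v \<in> I \<Longrightarrow> w \<in> I \<Longrightarrow> v \<noteq> w \<Longrightarrow> W $ v $ w = 0"
    and i: "i \<notin> I"
  shows "0 \<le> schur W I i i"
proof -
  obtain p :: "'n \<Rightarrow> real^'n" where p: "\<And>i j. W $ i $ j = p i \<bullet> p j"
    using pos_semidef_imp_gram[OF W] by blast
  define y where "y = (\<Sum>v\<in>I. (W $ v $ i / W $ v $ v) *\<^sub>R p v)"
  have py: "p v \<bullet> y = (if W $ v $ v = 0 then 0 else W $ v $ i)" if "v \<in> I" for v
  proof -
    have "p v \<bullet> y = (\<Sum>w\<in>I. (W $ w $ i / W $ w $ w) * W $ v $ w)"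
      by (simp add: y_def inner_sum_right p)
    also have "\<dots> = (\<Sum>w\<in>{v}. (W $ w $ i / W $ w $ w) * W $ v $ w)"
      using that indep[of v] by (intro sum.mono_neutral_right) auto
    finally show ?thesis
      by simp
  qed
  have "y \<bullet> y = (\<Sum>v\<in>I. (W $ v $ i / W $ v $ v) * (p v \<bullet> y))"
    by (subst y_def) (simp add: inner_sum_left)
  also have "\<dots> = (\<Sum>v\<in>I. W $ v $ i * W $ v $ i / W $ v $ v)"
    by (rule sum.cong) (auto simp: py)
  finally have yy: "y \<bullet> y = (\<Sum>v\<in>I. W $ v $ i * W $ v $ i / W $ v $ v)" .
  have "p i \<bullet> y = (\<Sum>v\<in>I. W $ v $ i * W $ v $ i / W $ v $ v)"
    by (simp add: y_def inner_sum_right p inner_commute)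
  then have "schur W I i i = (p i - y) \<bullet> (p i - y)"
    by (simp add: schur_def p[of i i] yy inner_diff_left inner_diff_right inner_commute)
  then show ?thesis
    by simp
qed

text \<open>By Cramer's rule the nonzero minor expresses \<open>p k\<close> and \<open>p l\<close>
  through the remaining vectors.\<close>

lemma dim_le_two_relations:
  fixes p :: "'n \<Rightarrow> 'a::euclidean_space"
  assumes A: "finite A" "k \<in> A" "l \<in> A" "k \<noteq> l"
    and c: "(\<Sum>j\<in>A. c j *\<^sub>R p j) = 0" and d: "(\<Sum>j\<in>A. d j *\<^sub>R p j) = 0"
    and minor: "c k * d l \<noteq> c l * d k"
  shows "dim (p ` A) \<le> card A - 2"
proof -
  let ?B = "A - {k, l}"
  let ?V = "span (p ` ?B)"
  have split: "(\<Sum>j\<in>A. f j *\<^sub>R p j) = f k *\<^sub>R p k + f l *\<^sub>R p l + (\<Sum>j\<in>?B. f j *\<^sub>R p j)" for f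
  proof -
    have "A = insert k (insert l ?B)"
      using A by blast
    then have "(\<Sum>j\<in>A. f j *\<^sub>R p j) = (\<Sum>j\<in>insert k (insert l ?B). f j *\<^sub>R p j)"
      by (rule arg_cong)
    then show ?thesis
      using A by (simp add: add.assoc)
  qed
  have rest: "(\<Sum>j\<in>?B. f j *\<^sub>R p j) \<in> ?V" for f
    by (intro span_sum span_scale span_base) auto
  have c': "c k *\<^sub>R p k + c l *\<^sub>R p l \<in> ?V"
    using c rest[of c] unfolding split by (metis add_eq_0_iff2 span_neg)
  have d': "d k *\<^sub>R p k + d l *\<^sub>R p l \<in> ?V"
    using d rest[of d] unfolding split by (metis add_eq_0_iff2 span_neg)
  let ?m = "c k * d l - c l * d k"
  have "d l *\<^sub>R (c k *\<^sub>R p k + c l *\<^sub>R p l) - c l *\<^sub>R (d k *\<^sub>R p k + d l *\<^sub>R p l) \<in> ?V"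
    by (intro span_diff span_scale c' d')
  then have "?m *\<^sub>R p k \<in> ?V"
    by (simp add: algebra_simps)
  from span_scale[OF this, of "1 / ?m"] have pk: "p k \<in> ?V"
    using minor by simp
  have "c k *\<^sub>R (d k *\<^sub>R p k + d l *\<^sub>R p l) - d k *\<^sub>R (c k *\<^sub>R p k + c l *\<^sub>R p l) \<in> ?V"
    by (intro span_diff span_scale c' d')
  then have "?m *\<^sub>R p l \<in> ?V"
    by (simp add: algebra_simps)
  from span_scale[OF this, of "1 / ?m"] have pl: "p l \<in> ?V"
    using minor by simp
  have "p ` A \<subseteq> ?V"
  proof
    fix x
    assume "x \<in> p ` A"
    then obtain j where "j \<in> A" "x = p j"
      by blast
    then show "x \<in> ?V"
      using pk pl by (cases "j \<in> ?B") (auto intro: span_base)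
  qed
  then have "dim (p ` A) \<le> card (p ` ?B)"
    using A(1) by (intro dim_le_card) auto
  also have "\<dots> \<le> card ?B"
    using A(1) by (intro card_image_le) auto
  also have "\<dots> = card A - 2"
    using A by simp
  finally show ?thesis .
qed

section \<open>Realisation in a space of smaller dimension\<close>

text \<open>Polarisation inside \<open>S\<close>.\<close>

lemma isometry_inner_eq:
  fixes f :: "'a::real_inner \<Rightarrow> 'b::real_inner"
  assumes f: "linear f" and S: "subspace S" and iso: "\<And>x. x \<in> S \<Longrightarrow> norm (f x) = norm x"
    and xy: "x \<in> S" "y \<in> S"
  shows "f x \<bullet> f y = x \<bullet> y"
proof -
  have "norm (f x + f y) = norm (x + y)"
    using iso[of "x + y"] xy S by (simp add: linear_add[OF f] subspace_add)
  then show ?thesis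
    using iso[OF xy(1)] iso[OF xy(2)] by (simp add: dot_norm)
qed

text \<open>Split \<open>z\<close> into \<open>y\<close> in the span of its neighbours and
  \<open>w\<close> orthogonal to it. Transport \<open>y\<close> by \<open>f\<close> and replace
  \<open>w\<close> by an equally long vector orthogonal to the images of the neighbours, for which
  \<open>card N < DIM('b)\<close> leaves room.\<close>

lemma place_vertex:
  fixes p :: "'n \<Rightarrow> 'a::euclidean_space" and f :: "'a \<Rightarrow> 'b::euclidean_space" and z :: 'a
  assumes f: "linear f" and S: "subspace S" and iso: "\<And>x. x \<in> S \<Longrightarrow> norm (f x) = norm x"
    and N: "finite N" "p ` N \<subseteq> S" "card N < DIM('b)"
  obtains q where "q \<bullet> q = z \<bullet> z" "\<And>j. j \<in> N \<Longrightarrow> q \<bullet> f (p j) = z \<bullet> p j"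
proof -
  obtain y w where y: "y \<in> span (p ` N)" and w: "\<And>u. u \<in> span (p ` N) \<Longrightarrow> orthogonal w u" and z: "z = y + w"
    using orthogonal_subspace_decomp_exists[of "p ` N" z] by blast
  have yS: "y \<in> S"
    using y span_minimal[OF N(2) S] by blast
  have "dim (f ` p ` N) \<le> card N"
    using N(1) by (metis card_image_le dim_le_card' finite_imageI image_image order_trans)
  then obtain e where "e \<noteq> 0" and e: "\<And>u. u \<in> span (f ` p ` N) \<Longrightarrow> orthogonal e u"
    using orthogonal_to_subspace_exists[of "f ` p ` N"] N(3) by auto
  define q where "q = f y + (norm w / norm e) *\<^sub>R e"
  have fy: "f y \<in> span (f ` p ` N)"
    using y by (simp add: linear_span_image[OF f])
  have "y \<bullet> w = 0" "f y \<bullet> e = 0"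
    using w[OF y] e[OF fy] by (simp_all add: orthogonal_def inner_commute)
  then have "q \<bullet> q = f y \<bullet> f y + (norm w / norm e)\<^sup>2 * (e \<bullet> e)"
    by (simp add: q_def inner_add_left inner_add_right inner_commute power2_eq_square)
  also have "\<dots> = y \<bullet> y + w \<bullet> w"
    using \<open>e \<noteq> 0\<close> by (simp add: iso[OF yS] power_divide dot_square_norm)
  also have "\<dots> = z \<bullet> z"
    using \<open>y \<bullet> w = 0\<close> by (simp add: z inner_add_left inner_add_right inner_commute)
  finally have "q \<bullet> q = z \<bullet> z" .
  moreover have "q \<bullet> f (p j) = z \<bullet> p j" if "j \<in> N" for j
  proof -
    have "w \<bullet> p j = 0" "e \<bullet> f (p j) = 0"
      using w[of "p j"] e[of "f (p j)"] that by (auto simp: orthogonal_def intro: span_base)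
    moreover have "f y \<bullet> f (p j) = y \<bullet> p j"
      using that N(2) by (intro isometry_inner_eq[OF f S iso yS]) auto
    ultimately show ?thesis
      by (simp add: q_def z inner_add_left)
  qed
  ultimately show thesis
    by (rule that)
qed

text \<open>The vectors outside \<open>I\<close> move together by an isometry. All neighbours of a
  vertex of \<open>I\<close> are outside \<open>I\<close>, so the vertices of \<open>I\<close> are
  placed one by one without interaction.\<close>

lemma realise_eliminating_independent_set:
  fixes p :: "'n::finite \<Rightarrow> 'a::euclidean_space"
  assumes dim: "dim (p ` (- I)) \<le> DIM('b::euclidean_space)"
    and indep: "\<And>v w. v \<in> I \<Longrightarrow> w \<in> I \<Longrightarrow> {v, w} \<notin> E"
    and deg: "\<And>v. v \<in> I \<Longrightarrow> card {j. {v, j} \<in> E} < DIM('b::euclidean_space)"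
  obtains q :: "'n \<Rightarrow> 'b::euclidean_space" where "\<And>i. q i \<bullet> q i = p i \<bullet> p i" "\<And>i j. {i, j} \<in> E \<Longrightarrow> q i \<bullet> q j = p i \<bullet> p j"
proof -
  let ?S = "span (p ` (- I))"
  obtain f :: "'a \<Rightarrow> 'b" where f: "linear f" and iso: "\<And>x. x \<in> ?S \<Longrightarrow> norm (f x) = norm x"
    using isometry_subset_subspace[of ?S "UNIV :: 'b set"] dim by (auto simp: dim_UNIV)
  have "\<exists>q. q \<bullet> q = p v \<bullet> p v \<and> (\<forall>j. {v, j} \<in> E \<longrightarrow> q \<bullet> f (p j) = p v \<bullet> p j)" if v: "v \<in> I" for v
  proof -
    have "{j. {v, j} \<in> E} \<subseteq> - I"
      using indep[OF v] by blast
    then have "p ` {j. {v, j} \<in> E} \<subseteq> ?S"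
      by (meson image_mono order_trans span_superset)
    note place = place_vertex[where f = f and S = ?S and p = p and N = "{j. {v, j} \<in> E}" and z = "p v",
        OF f subspace_span _ finite this deg[OF v]]
    show ?thesis
      by (rule place) (use iso in auto)
  qed
  then have "\<exists>g. \<forall>v\<in>I. g v \<bullet> g v = p v \<bullet> p v \<and> (\<forall>j. {v, j} \<in> E \<longrightarrow> g v \<bullet> f (p j) = p v \<bullet> p j)"
    by (intro bchoice) blast
  then obtain g where g: "\<And>v. v \<in> I \<Longrightarrow> g v \<bullet> g v = p v \<bullet> p v"
    "\<And>v j. v \<in> I \<Longrightarrow> {v, j} \<in> E \<Longrightarrow> g v \<bullet> f (p j) = p v \<bullet> p j"
    by blast
  define q where "q i = (if i \<in> I then g i else f (p i))" for i
  have f_inner: "f (p i) \<bullet> f (p j) = p i \<bullet> p j" if "i \<notin> I" "j \<notin> I" for i j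
    using that by (intro isometry_inner_eq[OF f subspace_span iso]) (auto intro: span_base)
  show thesis
  proof
    show "q i \<bullet> q i = p i \<bullet> p i" for i
      by (simp add: q_def g f_inner)
    show "q i \<bullet> q j = p i \<bullet> p j" if ij: "{i, j} \<in> E" for i j
    proof -
      have ji: "{j, i} \<in> E"
        using ij by (simp add: insert_commute)
      consider "i \<in> I" "j \<notin> I" | "i \<notin> I" "j \<in> I" | "i \<notin> I" "j \<notin> I"
        using indep ij by blast
      then show ?thesis
      proof cases
        case 1
        then show ?thesis
          using g(2)[OF _ ij] by (simp add: q_def)
      next
        case 2
        then show ?thesis
          using g(2)[OF _ ji] by (simp add: q_def inner_commute)
      next
        case 3
        then show ?thesis
          by (simp add: q_def f_inner)
      qed
    qed
  qed
qed

text \<open>This undoes the diagonal shift. Realisations for shifts \<open>1 / (n + 1)\<close> have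
  bounded length, so a subsequence converges, and inner products pass to the limit.\<close>

lemma realisable_limit:
  fixes X :: "real^'n^'n"
  assumes "\<And>d. 0 < d \<Longrightarrow> \<exists>q :: 'n \<Rightarrow> 'a::euclidean_space. (\<forall>i. q i \<bullet> q i = X $ i $ i + d) \<and>
    (\<forall>i j. {i, j} \<in> E \<longrightarrow> q i \<bullet> q j = X $ i $ j)"
  shows "\<exists>q :: 'n \<Rightarrow> 'a. (\<forall>i. q i \<bullet> q i = X $ i $ i) \<and> (\<forall>i j. {i, j} \<in> E \<longrightarrow> q i \<bullet> q j = X $ i $ j)"
proof -
  define d where "d n = inverse (real (Suc n))" for n
  have "\<exists>q :: 'a^'n. (\<forall>i. q $ i \<bullet> q $ i = X $ i $ i + d n) \<and>
      (\<forall>i j. {i, j} \<in> E \<longrightarrow> q $ i \<bullet> q $ j = X $ i $ j)" for n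
  proof -
    obtain q :: "'n \<Rightarrow> 'a" where "\<forall>i. q i \<bullet> q i = X $ i $ i + d n" "\<forall>i j. {i, j} \<in> E \<longrightarrow> q i \<bullet> q j = X $ i $ j"
      using assms[of "d n"] by (auto simp: d_def)
    then show ?thesis
      by (intro exI[of _ "\<chi> i. q i"]) simp
  qed
  then obtain q :: "nat \<Rightarrow> 'a^'n" where
    q: "\<And>n i. q n $ i \<bullet> q n $ i = X $ i $ i + d n" "\<And>n i j. {i, j} \<in> E \<Longrightarrow> q n $ i \<bullet> q n $ j = X $ i $ j"
    by metis
  have d: "d \<longlonglongrightarrow> 0"
    unfolding d_def by (rule LIMSEQ_inverse_real_of_nat)
  define K where "K = (\<Sum>i\<in>UNIV. sqrt (X $ i $ i + 1))"
  have "norm (q n) \<le> K" for n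
  proof -
    have "norm (q n $ i) \<le> sqrt (X $ i $ i + 1)" for i
    proof -
      have "d n \<le> 1"
        by (simp add: d_def field_simps)
      then show ?thesis
        by (simp add: norm_eq_sqrt_inner q)
    qed
    moreover have "norm (q n) \<le> (\<Sum>i\<in>UNIV. norm (q n $ i))"
      unfolding norm_vec_def by (rule L2_set_le_sum) simp
    ultimately show ?thesis
      unfolding K_def by (meson order_trans sum_mono)
  qed
  then have "\<forall>n. q n \<in> cball 0 K"
    by simp
  then obtain l and r :: "nat \<Rightarrow> nat" where r: "strict_mono r" and l: "(q \<circ> r) \<longlonglongrightarrow> l"
    using compact_cball[of "0 :: 'a^'n" K] unfolding compact_def by blast
  have lim: "(\<lambda>n. q (r n) $ i \<bullet> q (r n) $ j) \<longlonglongrightarrow> l $ i \<bullet> l $ j" for i j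
    using l unfolding comp_def by (intro tendsto_intros)
  have "l $ i \<bullet> l $ i = X $ i $ i" for i
  proof (rule LIMSEQ_unique[OF lim])
    have "(\<lambda>n. X $ i $ i + d (r n)) \<longlonglongrightarrow> X $ i $ i + 0"
      using LIMSEQ_subseq_LIMSEQ[OF d r] unfolding comp_def by (intro tendsto_intros)
    then show "(\<lambda>n. q (r n) $ i \<bullet> q (r n) $ i) \<longlonglongrightarrow> X $ i $ i"
      by (simp add: q)
  qed
  moreover have "l $ i \<bullet> l $ j = X $ i $ j" if "{i, j} \<in> E" for i j
    using lim[of i j] by (simp add: q that LIMSEQ_const_iff)
  ultimately show ?thesis
    by (intro exI[of _ "\<lambda>i. l $ i"]) simp
qed

lemma rank_gram_matrix_le:
  fixes q :: "'n::finite \<Rightarrow> real^'m"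
  shows "rank ((\<chi> i j. q i \<bullet> q j) :: real^'n^'n) \<le> CARD('m)"
proof -
  have "(\<chi> i j. q i \<bullet> q j) = (\<chi> i. q i) ** transpose (\<chi> i. q i)"
    by (simp add: vec_eq_iff matrix_matrix_mult_def transpose_def inner_vec_def)
  then have "rank ((\<chi> i j. q i \<bullet> q j) :: real^'n^'n) \<le> rank (transpose (\<chi> i. q i))"
    by (simp add: rank_mul_le_right)
  also have "\<dots> \<le> CARD('m)"
    using rank_bound[of "transpose (\<chi> i. q i)"] by simp
  finally show ?thesis .
qed

section \<open>The pentagonal prism\<close>

lemma UNIV_10: "(UNIV :: 10 set) = {1, 2, 3, 4, 5, 6, 7, 8, 9, 10}"
  by (rule card_subset_eq[symmetric]) simp_all

abbreviation elim_set :: "10 set" where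
  "elim_set \<equiv> {1, 4, 5, 8}"

lemma Compl_elim_set: "- elim_set = {2, 3, 6, 7, 9, 10}"
  unfolding Compl_eq_Diff_UNIV UNIV_10 by auto

text \<open>On symmetric matrices the inner product with this one is twice the sum of the three
  antipodal entries.\<close>

definition objective :: "real^10^10" where
  "objective = (\<chi> i j. if {i, j} \<in> {{3, 10}, {2, 7}, {6, 9}} then 1 else 0)"

section \<open>Sign argument along the four triangles\<close>

text \<open>In the triangle of a vertex \<open>v\<close>, \<open>d\<close> stands for
  \<open>W $ v $ v\<close> and \<open>x, y, z\<close> for its entries at the three neighbours.
  Multiplying the two sign hypotheses and using the vanishing minor fixes the sign of the third
  product. The summand \<open>k\<close> absorbs the term of the preceding triangle on a shared
  edge.\<close>

lemma triangle_step:
  fixes d x y z k sii sij sik sjk :: real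
  assumes "0 \<le> d" "0 \<le> k" "0 < sii" "sij \<noteq> 0" "sik \<noteq> 0"
    and xy: "- (x * y / d) = (1 + k) * sij" and xz: "- (x * z / d) = sik" and minor: "sij * sik = sii * sjk"
  shows "\<exists>k'>0. y * z / d = k' * sjk"
proof -
  \<comment> \<open>Division by zero yields 0, so \<open>d = 0\<close> would contradict
    \<open>sik \<noteq> 0\<close>.\<close>
  have "d \<noteq> 0" "x \<noteq> 0"
    using xz \<open>sik \<noteq> 0\<close> by auto
  then have pos: "0 < d" "0 < x\<^sup>2"
    using \<open>0 \<le> d\<close> by auto
  have "(x\<^sup>2 / d) * (y * z / d) = (x * y / d) * (x * z / d)"
    by (simp add: power2_eq_square)
  also have "\<dots> = (1 + k) * (sij * sik)"
    using xy xz by (metis minus_mult_minus mult.assoc)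
  finally have "(x\<^sup>2 / d) * (y * z / d) = (1 + k) * sii * sjk"
    by (simp add: minor)
  then have "y * z / d = ((1 + k) * sii * (d / x\<^sup>2)) * sjk"
    using pos by (simp add: field_simps)
  moreover have "0 < (1 + k) * sii * (d / x\<^sup>2)"
    using pos assms(2,3) by simp
  ultimately show ?thesis
    by blast
qed

lemma prism_schur_has_minor:
  fixes W :: "real^10^10"
  assumes W: "pos_semidef W"
    and off: "\<And>i j. i \<noteq> j \<Longrightarrow> {i, j} \<notin> C5_times_C2 \<Longrightarrow> W $ i $ j = - objective $ i $ j"
  obtains i j k l where "k \<notin> elim_set" "l \<notin> elim_set"
    "schur W elim_set i k * schur W elim_set j l \<noteq> schur W elim_set i l * schur W elim_set j k"
proof (rule ccontr)
  define S where "S = schur W elim_set"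
  note witness = that
  assume "\<not> thesis"
  \<comment> \<open>The negated claim says that the six columns of \<open>S\<close> have rank at
    most 1.\<close>
  then have minors: "S i k * S j l = S i l * S j k" if "k \<in> {2, 3, 6, 7, 9, 10}" "l \<in> {2, 3, 6, 7, 9, 10}" for i j k l
    using that witness[of k l i j] unfolding S_def Compl_elim_set[symmetric] by blast
  have W0: "W $ i $ j = - (if {i, j} \<in> {{3, 10}, {2, 7}, {6, 9}} then 1 else 0)"
    if "i \<noteq> j" "{i, j} \<notin> C5_times_C2" for i j
    using off[OF that] by (simp add: objective_def)
  have zero: "W $ 1 $ 6 = 0" "W $ 1 $ 7 = 0" "W $ 1 $ 10 = 0" "W $ 4 $ 7 = 0" "W $ 4 $ 9 = 0" "W $ 4 $ 10 = 0"
    "W $ 5 $ 2 = 0" "W $ 5 $ 9 = 0" "W $ 5 $ 10 = 0" "W $ 8 $ 2 = 0" "W $ 8 $ 3 = 0" "W $ 8 $ 9 = 0"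
    "W $ 9 $ 3 = 0" "W $ 9 $ 2 = 0" "W $ 3 $ 2 = 0" "W $ 2 $ 6 = 0" "W $ 3 $ 6 = 0" "W $ 3 $ 7 = 0"
    "W $ 6 $ 7 = 0" "W $ 6 $ 10 = 0" "W $ 7 $ 10 = 0"
    "W $ 3 $ 10 = - 1" "W $ 2 $ 7 = - 1" "W $ 6 $ 9 = - 1"
    by (subst W0; simp add: C5_times_C2_def doubleton_eq_iff)+
  have S: "S i j = W $ i $ j - (W $ 1 $ i * W $ 1 $ j / W $ 1 $ 1 + (W $ 4 $ i * W $ 4 $ j / W $ 4 $ 4 +
      (W $ 5 $ i * W $ 5 $ j / W $ 5 $ 5 + W $ 8 $ i * W $ 8 $ j / W $ 8 $ 8)))" for i j
    by (simp add: S_def schur_def)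
  have S_nonneg: "0 \<le> S i i" if "i \<notin> elim_set" for i
    unfolding S_def
  proof (rule schur_diag_nonneg[OF W _ that])
    fix v w :: 10
    assume "v \<in> elim_set" "w \<in> elim_set" "v \<noteq> w"
    then show "W $ v $ w = 0"
      by (subst W0) (auto simp: C5_times_C2_def doubleton_eq_iff)
  qed
  have S_commute: "S i j = S j i" for i j
    unfolding S_def by (rule schur_commute[OF W])
  \<comment> \<open>No vertex of \<open>elim_set\<close> is adjacent to both ends of an antipodal
    pair, so elimination leaves these entries unchanged.\<close>
  have "S 3 10 = - 1" "S 2 7 = - 1" "S 6 9 = - 1"
    by (simp_all add: S zero)
  then have "S 3 3 * S 10 10 = 1" "S 2 2 * S 7 7 = 1" "S 6 6 * S 9 9 = 1"
    using minors[of 3 10 3 10] minors[of 2 7 2 7] minors[of 6 9 6 9]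
      S_commute[of 10 3] S_commute[of 7 2] S_commute[of 9 6] by simp_all
  then have "S i i \<noteq> 0" if "i \<in> {2, 3, 6, 7, 9, 10}" for i
    using that by auto
  then have pos: "0 < S i i" if "i \<in> {2, 3, 6, 7, 9, 10}" for i
    using that S_nonneg[of i] unfolding Compl_elim_set[symmetric] by (simp add: order_less_le)
  have nz: "S i j \<noteq> 0" if "i \<in> {2, 3, 6, 7, 9, 10}" "j \<in> {2, 3, 6, 7, 9, 10}" for i j
    using minors[OF that, of i j] pos[OF that(1)] pos[OF that(2)] by auto
  have d: "0 \<le> W $ v $ v" for v
    by (rule pos_semidef_diag_nonneg[OF W])
  have minor: "S i j * S i k = S i i * S j k" if "i \<in> {2, 3, 6, 7, 9, 10}" "k \<in> {2, 3, 6, 7, 9, 10}" for i j k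
    using minors[OF that, of j i] by (simp add: S_commute[of j i] mult.commute)
  have step: "\<exists>k'>0. W $ v $ j * W $ v $ l / W $ v $ v = k' * S j l"
    if J: "i \<in> {2, 3, 6, 7, 9, 10}" "j \<in> {2, 3, 6, 7, 9, 10}" "l \<in> {2, 3, 6, 7, 9, 10}" and "0 \<le> k"
      and ij: "- (W $ v $ i * W $ v $ j / W $ v $ v) = (1 + k) * S i j"
      and il: "- (W $ v $ i * W $ v $ l / W $ v $ v) = S i l" for v i j l k
    by (rule triangle_step[OF d \<open>0 \<le> k\<close> pos[OF J(1)] nz[OF J(1,2)] nz[OF J(1,3)] ij il minor[OF J(1,3)]])
  \<comment> \<open>The edges 93 and 92 lie only in the triangle of vertex 1, so the chain starts
    with \<open>k = 0\<close>.\<close>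
  have "\<exists>k>0. W $ 1 $ 3 * W $ 1 $ 2 / W $ 1 $ 1 = k * S 3 2"
  proof (rule step[where i = 9 and k = 0])
    show "- (W $ 1 $ 9 * W $ 1 $ 3 / W $ 1 $ 1) = (1 + 0) * S 9 3"
      by (simp add: S zero)
    show "- (W $ 1 $ 9 * W $ 1 $ 2 / W $ 1 $ 1) = S 9 2"
      by (simp add: S zero)
  qed simp_all
  then obtain k1 where k1: "0 < k1" "W $ 1 $ 3 * W $ 1 $ 2 / W $ 1 $ 1 = k1 * S 3 2"
    by blast
  \<comment> \<open>The entry at the shared edge 23 has terms from vertices 1 and 4. The first is
    \<open>k1\<close> times the entry, so minus the second is \<open>1 + k1\<close> times it. The
    edges 36 and 67 continue the chain likewise.\<close>
  have "\<exists>k>0. W $ 4 $ 3 * W $ 4 $ 6 / W $ 4 $ 4 = k * S 3 6"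
  proof (rule step[where i = 2 and k = k1])
    show "- (W $ 4 $ 2 * W $ 4 $ 3 / W $ 4 $ 4) = (1 + k1) * S 2 3"
      unfolding S_commute[of 2 3] distrib_right mult_1_left k1(2)[symmetric] by (simp add: S zero)
    show "- (W $ 4 $ 2 * W $ 4 $ 6 / W $ 4 $ 4) = S 2 6"
      by (simp add: S zero)
  qed (use k1(1) in simp_all)
  then obtain k2 where k2: "0 < k2" "W $ 4 $ 3 * W $ 4 $ 6 / W $ 4 $ 4 = k2 * S 3 6"
    by blast
  have "\<exists>k>0. W $ 5 $ 6 * W $ 5 $ 7 / W $ 5 $ 5 = k * S 6 7"
  proof (rule step[where i = 3 and k = k2])
    show "- (W $ 5 $ 3 * W $ 5 $ 6 / W $ 5 $ 5) = (1 + k2) * S 3 6"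
      unfolding distrib_right mult_1_left k2(2)[symmetric] by (simp add: S zero)
    show "- (W $ 5 $ 3 * W $ 5 $ 7 / W $ 5 $ 5) = S 3 7"
      by (simp add: S zero)
  qed (use k2(1) in simp_all)
  then obtain k3 where k3: "0 < k3" "W $ 5 $ 6 * W $ 5 $ 7 / W $ 5 $ 5 = k3 * S 6 7"
    by blast
  have "\<exists>k>0. W $ 8 $ 7 * W $ 8 $ 10 / W $ 8 $ 8 = k * S 7 10"
  proof (rule step[where i = 6 and k = k3])
    show "- (W $ 8 $ 6 * W $ 8 $ 7 / W $ 8 $ 8) = (1 + k3) * S 6 7"
      unfolding distrib_right mult_1_left k3(2)[symmetric] by (simp add: S zero)
    show "- (W $ 8 $ 6 * W $ 8 $ 10 / W $ 8 $ 8) = S 6 10"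
      by (simp add: S zero)
  qed (use k3(1) in simp_all)
  then obtain k4 where k4: "0 < k4" "W $ 8 $ 7 * W $ 8 $ 10 / W $ 8 $ 8 = k4 * S 7 10"
    by blast
  \<comment> \<open>The edge 7,10 lies only in the triangle of vertex 8, so its term is opposite to
    \<open>S 7 10\<close>, while the chain gives it the same sign.\<close>
  have "S 7 10 = - (W $ 8 $ 7 * W $ 8 $ 10 / W $ 8 $ 8)"
    by (simp add: S zero)
  then have "(1 + k4) * S 7 10 = 0"
    using k4(2) by (simp add: algebra_simps)
  then show False
    using k4(1) nz[of 7 10] by simp
qed

section \<open>Upper bound: realisation in four dimensions\<close>

lemma prism_realisable_shift:
  fixes X :: "real^10^10"
  assumes X: "pos_semidef X" and "0 < d"
  shows "\<exists>q :: 10 \<Rightarrow> real^4. (\<forall>i. q i \<bullet> q i = X $ i $ i + d) \<and>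
    (\<forall>i j. {i, j} \<in> C5_times_C2 \<longrightarrow> q i \<bullet> q j = X $ i $ j)"
proof -
  have obj: "transpose objective = objective" "objective \<noteq> 0" "objective $ i $ i = 0"
    "{i, j} \<in> C5_times_C2 \<Longrightarrow> objective $ i $ j = 0" for i j
  proof -
    show "transpose objective = objective"
      by (simp add: transpose_def objective_def vec_eq_iff insert_commute)
    have "objective $ 3 $ 10 = 1"
      by (simp add: objective_def)
    then show "objective \<noteq> 0"
      by (metis zero_index zero_neq_one)
    show "objective $ i $ i = 0"
      by (simp add: objective_def doubleton_eq_iff)
    have "{{3, 10}, {2, 7}, {6, 9}} \<inter> C5_times_C2 = {}"
      by (simp add: C5_times_C2_def doubleton_eq_iff)
    then show "objective $ i $ j = 0" if "{i, j} \<in> C5_times_C2"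
      using that unfolding objective_def by auto
  qed
  obtain Y W where Y: "Y \<in> completions C5_times_C2 (X + mat d)" and W: "pos_semidef W" and WY: "W \<bullet> Y = 0"
    and off: "\<And>i j. i \<noteq> j \<Longrightarrow> {i, j} \<notin> C5_times_C2 \<Longrightarrow> W $ i $ j = - objective $ i $ j"
    using optimal_completion_stress[OF X \<open>0 < d\<close> obj] by blast
  have "pos_semidef Y"
    using Y by (simp add: completions_def)
  then obtain p :: "10 \<Rightarrow> real^10" where p: "\<And>i j. Y $ i $ j = p i \<bullet> p j"
    using pos_semidef_imp_gram by blast
  then have "Y = (\<chi> i j. p i \<bullet> p j)"
    by (simp add: vec_eq_iff)
  then have rel: "(\<Sum>j\<in>UNIV. W $ i $ j *\<^sub>R p j) = 0" for i
    using stress_annihilates_gram_vectors[OF W, of p] WY by simp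
  have indep: "{v, w} \<notin> C5_times_C2" if "v \<in> elim_set" "w \<in> elim_set" for v w
    using that by (auto simp: C5_times_C2_def doubleton_eq_iff)
  have "W $ v $ w = 0" if "v \<in> elim_set" "w \<in> elim_set" "v \<noteq> w" for v w
    using off[OF that(3) indep[OF that(1,2)]] that by (auto simp: objective_def doubleton_eq_iff)
  then have schur_rel: "(\<Sum>j\<in>-elim_set. schur W elim_set i j *\<^sub>R p j) = 0" for i
    by (intro schur_relation[OF W _ rel])
  obtain i j k l where kl: "k \<notin> elim_set" "l \<notin> elim_set"
    and minor: "schur W elim_set i k * schur W elim_set j l \<noteq> schur W elim_set i l * schur W elim_set j k"
  proof (rule prism_schur_has_minor[OF W])
    show "W $ i $ j = - objective $ i $ j" if "i \<noteq> j" "{i, j} \<notin> C5_times_C2" for i j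
      using that by (rule off)
  qed (rule that)
  then have "k \<noteq> l"
    by (auto simp: mult.commute)
  then have "dim (p ` (- elim_set)) \<le> card (- elim_set) - 2"
    using kl minor by (intro dim_le_two_relations[OF _ _ _ _ schur_rel schur_rel]) auto
  then have dim: "dim (p ` (- elim_set)) \<le> DIM(real^4)"
    unfolding Compl_elim_set by simp
  have deg: "card {j. {v, j} \<in> C5_times_C2} < DIM(real^4)" if "v \<in> elim_set" for v
  proof -
    have "{j. {1, j} \<in> C5_times_C2} = {3, 9, 2}" "{j. {4, j} \<in> C5_times_C2} = {2, 6, 3}"
      "{j. {5, j} \<in> C5_times_C2} = {3, 7, 6}" "{j. {8, j} \<in> C5_times_C2} = {6, 10, 7}"
      by (auto simp: C5_times_C2_def doubleton_eq_iff)
    then show ?thesis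
      using that by auto
  qed
  obtain q :: "10 \<Rightarrow> real^4" where q: "\<And>i. q i \<bullet> q i = p i \<bullet> p i"
    "\<And>i j. {i, j} \<in> C5_times_C2 \<Longrightarrow> q i \<bullet> q j = p i \<bullet> p j"
  proof (rule realise_eliminating_independent_set[OF dim])
    show "{v, w} \<notin> C5_times_C2" if "v \<in> elim_set" "w \<in> elim_set" for v w
      using that by (rule indep)
    show "card {j. {v, j} \<in> C5_times_C2} < DIM(real^4)" if "v \<in> elim_set" for v
      using that by (rule deg)
  qed (rule that)
  have "q i \<bullet> q i = X $ i $ i + d" for i
    using Y by (simp add: q p[symmetric] completions_def mat_def)
  moreover have "q i \<bullet> q j = X $ i $ j" if "{i, j} \<in> C5_times_C2" for i j
  proof -
    have "i \<noteq> j"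
      using that C5_times_C2_simple by fastforce
    then show ?thesis
      using Y that by (simp add: q p[symmetric] completions_def mat_def)
  qed
  ultimately show ?thesis
    by blast
qed

lemma gram_bound_prism_4: "gram_bound C5_times_C2 4"
  unfolding gram_bound_def
proof (intro allI impI)
  fix X :: "real^10^10"
  assume "pos_semidef X"
  then obtain q :: "10 \<Rightarrow> real^4" where q: "\<And>i. q i \<bullet> q i = X $ i $ i"
    "\<And>i j. {i, j} \<in> C5_times_C2 \<Longrightarrow> q i \<bullet> q j = X $ i $ j"
    using realisable_limit[of X C5_times_C2, OF prism_realisable_shift] by blast
  show "\<exists>X'. pos_semidef X' \<and> rank X' \<le> 4 \<and> (\<forall>i. X' $ i $ i = X $ i $ i) \<and>
      (\<forall>i j. {i, j} \<in> C5_times_C2 \<longrightarrow> X' $ i $ j = X $ i $ j)"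
    using rank_gram_matrix_le[of q] pos_semidef_gram_matrix[of q]
    by (intro exI[of _ "\<chi> i j. q i \<bullet> q j"]) (simp add: q)
qed

section \<open>Lower bound from a complete minor\<close>

text \<open>The classes of \<open>branch\<close> are the branch sets of a \<open>K\<^sub>4\<close> minor. The entry 1 on an edge
  inside a class forces equality of the two unit vectors in every completion.\<close>

definition branch :: "10 \<Rightarrow> 4" where
  "branch i = (if i = 1 then 1 else if i = 3 then 2 else if i \<in> {5, 7, 9} then 3 else 4)"

text \<open>Vectors of a completion agree along edges inside a class and are orthogonal along edges
  between classes. Any two classes are joined by an edge, so the vectors at 1, 3, 5, 2 are
  orthonormal.\<close>

lemma gram_bound_prism_ge_4:
  assumes "gram_bound C5_times_C2 k"
  shows "4 \<le> k"
proof -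
  define X :: "real^10^10" where "X = (\<chi> i j. axis (branch i) 1 \<bullet> (axis (branch j) 1 :: real^4))"
  have X: "X $ i $ j = (if branch i = branch j then 1 else 0)" for i j
    by (simp add: X_def inner_axis_axis)
  have "pos_semidef X"
    unfolding X_def by (rule pos_semidef_gram_matrix)
  then obtain Y where Y: "pos_semidef Y" "rank Y \<le> k" "\<And>i. Y $ i $ i = X $ i $ i"
    "\<And>i j. {i, j} \<in> C5_times_C2 \<Longrightarrow> Y $ i $ j = X $ i $ j"
    using assms unfolding gram_bound_def by blast
  obtain p :: "10 \<Rightarrow> real^10" where p: "\<And>i j. Y $ i $ j = p i \<bullet> p j"
    using pos_semidef_imp_gram[OF Y(1)] by blast
  have norm: "p i \<bullet> p i = 1" for i
    using Y(3)[of i] by (simp add: p X)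
  have edge: "p i \<bullet> p j = (if branch i = branch j then 1 else 0)" if "{i, j} \<in> C5_times_C2" for i j
    using Y(4)[OF that] by (simp add: p X)
  have eq: "p i = p j" if "{i, j} \<in> C5_times_C2" "branch i = branch j" for i j
  proof -
    have "(p i - p j) \<bullet> (p i - p j) = 0"
      using edge[OF that(1)] that(2) by (simp add: inner_diff_left inner_diff_right norm inner_commute)
    then show ?thesis
      by simp
  qed
  have "p 5 = p 7" "p 7 = p 9" "p 2 = p 4" "p 4 = p 6"
    by (rule eq; simp add: C5_times_C2_def branch_def)+
  moreover have "p 1 \<bullet> p 3 = 0" "p 3 \<bullet> p 5 = 0" "p 9 \<bullet> p 1 = 0" "p 1 \<bullet> p 2 = 0" "p 3 \<bullet> p 4 = 0" "p 5 \<bullet> p 6 = 0"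
    by (subst edge; simp add: C5_times_C2_def branch_def)+
  ultimately have orth: "p 1 \<bullet> p 3 = 0" "p 1 \<bullet> p 5 = 0" "p 1 \<bullet> p 2 = 0" "p 3 \<bullet> p 5 = 0" "p 3 \<bullet> p 2 = 0" "p 5 \<bullet> p 2 = 0"
    by (simp_all add: inner_commute)
  \<comment> \<open>\<open>r\<close> picks a representative of each class, so that
    \<open>B ** Y ** transpose B\<close> is a principal submatrix of \<open>Y\<close>.\<close>
  define r :: "4 \<Rightarrow> 10" where "r a = (if a = 1 then 1 else if a = 2 then 3 else if a = 3 then 5 else 2)" for a
  define B :: "real^10^4" where "B = (\<chi> a. axis (r a) 1)"
  have "(B ** Y ** transpose B) $ a $ b = p (r a) \<bullet> p (r b)" for a b
    by (simp add: B_def matrix_matrix_mult_def transpose_def axis_def p if_distrib[of "\<lambda>t. t * _"]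
        if_distrib[of "\<lambda>t. _ * t"] cong: if_cong)
  moreover have "p (r a) \<bullet> p (r b) = (if a = b then 1 else 0)" for a b
    using exhaust_4[of a] exhaust_4[of b] orth norm by (auto simp: r_def inner_commute)
  ultimately have "B ** Y ** transpose B = mat 1"
    by (simp add: vec_eq_iff mat_def)
  then have "4 = rank (B ** Y ** transpose B)"
    by (simp add: rank_I)
  also have "\<dots> \<le> rank (B ** Y)"
    by (rule rank_mul_le_left)
  also have "\<dots> \<le> rank Y"
    by (rule rank_mul_le_right)
  finally show ?thesis
    using Y(2) by simp
qed

theorem theorem11:
  shows "gram_dim C5_times_C2 = 4"
  unfolding gram_dim_def
  by (rule Least_equality) (auto intro: gram_bound_prism_4 gram_bound_prism_ge_4)

end
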